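(* Let $\mathcal{H}_1,\mathcal{H}_2$ be separable complex Hilbert spaces, $\mathcal{H}=\mathcal{H}_1\otimes\mathcal{H}_2$, and let $(X,\mu)=(X_1\times X_2,\mu_1\otimes\mu_2)$ be the product of measure spaces with $\sigma$-finite positive measures. Let $F_j:X_j\to\mathcal{H}_j$ ($j=1,2$) be continuous frames for $\mathcal{H}_j$ with respect to $(X_j,\mu_j)$, so that $F_1\otimes F_2$ is a continuous frame for $\mathcal{H}$ with respect to $(X,\mu)$. Then the dual frames of $F_1\otimes F_2$ are precisely the families of the form $$S_{F_1}^{-1}F_1(x_1)\otimes S_{F_2}^{-1}F_2(x_2)+W(x_1,x_2)-\int_X\langle S_{F_1}^{-1}F_1(x_1),F_1(y_1)\rangle\langle S_{F_2}^{-1}F_2(x_2),F_2(y_2)\rangle\,W(y_1,y_2)\,d\mu(y),$$ $(x_1,x_2)\in X$, $y=(y_1,y_2)$, where $W:X\to\mathcal{H}$ is a Bessel mapping in $\mathcal{H}$.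
   Context: $\mathcal{H}_1\otimes\mathcal{H}_2$ is the Hilbert space tensor product; $(F_1\otimes F_2)(x_1,x_2)=F_1(x_1)\otimes F_2(x_2)$. A weakly measurable mapping $F:X\to\mathcal{K}$ into a separable Hilbert space is a continuous frame for $\mathcal{K}$ with respect to $(X,\mu)$ if there are $A>0$, $B<\infty$ with $A\|f\|^2\le\int_X|\langle f,F(x)\rangle|^2d\mu(x)\le B\|f\|^2$ for all $f\in\mathcal{K}$; it is a Bessel mapping if only the upper inequality is required. The frame operator $S_F$ of a continuous frame is the bounded invertible operator $S_Ff=\int_X\langle f,F(x)\rangle F(x)\,d\mu(x)$. All vector-valued integrals are understood in the weak sense. A continuous frame $G$ is a dual frame of $F$ if $\langle f,g\rangle=\int_X\langle f,F(x)\rangle\langle G(x),g\rangle\,d\mu(x)$ for all $f,g\in\mathcal{K}$. *)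

theory Defs
  imports "HOL-Analysis.Analysis"
begin

section \<open>Complex Hilbert spaces\<close>

text \<open>The complex inner product is linear in the first argument. A complex inner product space
  is a real one via the real part of its inner product, which provides the norm and the topology:
  norm x = sqrt (inner x x) = sqrt (Re (cinner x x)).\<close>

class complex_inner = real_inner +
  fixes scaleC :: "complex \<Rightarrow> 'a \<Rightarrow> 'a" (infixr \<open>*\<^sub>C\<close> 75)
    and cinner :: "'a \<Rightarrow> 'a \<Rightarrow> complex"
  assumes scaleC_add_right: "a *\<^sub>C (x + y) = a *\<^sub>C x + a *\<^sub>C y"
    and scaleC_add_left: "(a + b) *\<^sub>C x = a *\<^sub>C x + b *\<^sub>C x"
    and scaleC_scaleC: "a *\<^sub>C (b *\<^sub>C x) = (a * b) *\<^sub>C x"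
    and scaleR_eq_scaleC: "scaleR r x = complex_of_real r *\<^sub>C x"
    and cinner_commute: "cinner x y = cnj (cinner y x)"
    and cinner_add_left: "cinner (x + y) z = cinner x z + cinner y z"
    and cinner_scaleC_left: "cinner (a *\<^sub>C x) y = a * cinner x y"
    and inner_eq_Re_cinner: "inner x y = Re (cinner x y)"

class complex_hilbert = complex_inner + complete_space

instantiation complex :: complex_hilbert
begin

definition scaleC_complex :: "complex \<Rightarrow> complex \<Rightarrow> complex"
  where "scaleC_complex a x = a * x"

definition cinner_complex :: "complex \<Rightarrow> complex \<Rightarrow> complex"
  where "cinner_complex x y = x * cnj y"

instance
  by standard
    (auto simp: scaleC_complex_def cinner_complex_def algebra_simps scaleR_conv_of_real
      inner_complex_def)

end


section \<open>Hilbert space tensor products\<close>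

text \<open>A Hilbert space tensor product, up to unitary isomorphism: a Hilbert space with a bilinear
  map on pairs of vectors whose inner product on elementary tensors is the product of the inner
  products, and which is the completion of the span of the elementary tensors. The elementary
  tensors are closed under complex multiples, hence their real span is also their complex span.\<close>

definition hilbert_tensor_product ::
  "('a::complex_hilbert \<Rightarrow> 'b::complex_hilbert \<Rightarrow> 'c::complex_hilbert) \<Rightarrow> bool"
  where "hilbert_tensor_product tens \<longleftrightarrow>
    (\<forall>f f' g. tens (f + f') g = tens f g + tens f' g) \<and>
    (\<forall>f g g'. tens f (g + g') = tens f g + tens f g') \<and>
    (\<forall>c f g. tens (c *\<^sub>C f) g = c *\<^sub>C tens f g) \<and>
    (\<forall>c f g. tens f (c *\<^sub>C g) = c *\<^sub>C tens f g) \<and>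
    (\<forall>f f' g g'. cinner (tens f g) (tens f' g') = cinner f f' * cinner g g') \<and>
    closure (span {tens f g | f g. True}) = UNIV"

lemma hilbert_tensor_product_scaleC:
  "hilbert_tensor_product ((*\<^sub>C) :: complex \<Rightarrow> 'a \<Rightarrow> 'a::complex_hilbert)"
proof -
  have "cinner (a *\<^sub>C x) (b *\<^sub>C y) = (a * cnj b) * cinner x y" for a b and x y :: 'a
    by (metis cinner_commute cinner_scaleC_left complex_cnj_mult mult.assoc mult.commute)
  moreover have "{f *\<^sub>C g | f g. True} = (UNIV :: 'a set)"
    by (auto intro!: exI[of _ 1] simp: scaleR_eq_scaleC[of 1, simplified, symmetric])
  ultimately show ?thesis
    by (auto simp: hilbert_tensor_product_def scaleC_add_left scaleC_add_right scaleC_scaleC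
        scaleC_complex_def cinner_complex_def mult.commute)
qed


section \<open>Continuous frames\<close>

definition weakly_measurable :: "'x measure \<Rightarrow> ('x \<Rightarrow> 'a::complex_hilbert) \<Rightarrow> bool"
  where "weakly_measurable M F \<longleftrightarrow> (\<forall>f. (\<lambda>x. cinner f (F x)) \<in> borel_measurable M)"

definition bessel_mapping :: "'x measure \<Rightarrow> ('x \<Rightarrow> 'a::complex_hilbert) \<Rightarrow> bool"
  where "bessel_mapping M F \<longleftrightarrow> weakly_measurable M F \<and>
    (\<exists>B::real. \<forall>f. (\<integral>\<^sup>+ x. ennreal ((cmod (cinner f (F x)))\<^sup>2) \<partial>M) \<le> ennreal (B * (norm f)\<^sup>2))"

definition continuous_frame :: "'x measure \<Rightarrow> ('x \<Rightarrow> 'a::complex_hilbert) \<Rightarrow> bool"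
  where "continuous_frame M F \<longleftrightarrow> weakly_measurable M F \<and>
    (\<exists>A B::real. A > 0 \<and>
      (\<forall>f. ennreal (A * (norm f)\<^sup>2) \<le> (\<integral>\<^sup>+ x. ennreal ((cmod (cinner f (F x)))\<^sup>2) \<partial>M) \<and>
           (\<integral>\<^sup>+ x. ennreal ((cmod (cinner f (F x)))\<^sup>2) \<partial>M) \<le> ennreal (B * (norm f)\<^sup>2)))"

definition has_weak_integral ::
  "'x measure \<Rightarrow> ('x \<Rightarrow> 'a::complex_hilbert) \<Rightarrow> 'a \<Rightarrow> bool"
  where "has_weak_integral M h v \<longleftrightarrow>
    (\<forall>g. has_bochner_integral M (\<lambda>x. cinner (h x) g) (cinner v g))"

definition weak_integral :: "'x measure \<Rightarrow> ('x \<Rightarrow> 'a::complex_hilbert) \<Rightarrow> 'a"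
  where "weak_integral M h = (THE v. has_weak_integral M h v)"

definition frame_operator :: "'x measure \<Rightarrow> ('x \<Rightarrow> 'a::complex_hilbert) \<Rightarrow> 'a \<Rightarrow> 'a"
  where "frame_operator M F f = weak_integral M (\<lambda>x. cinner f (F x) *\<^sub>C F x)"

definition dual_frame ::
  "'x measure \<Rightarrow> ('x \<Rightarrow> 'a::complex_hilbert) \<Rightarrow> ('x \<Rightarrow> 'a) \<Rightarrow> bool"
  where "dual_frame M F G \<longleftrightarrow> continuous_frame M G \<and>
    (\<forall>f g. has_bochner_integral M (\<lambda>x. cinner f (F x) * cinner (G x) g) (cinner f g))"

definition tensor_map ::
  "('a \<Rightarrow> 'b \<Rightarrow> 'c) \<Rightarrow> ('x \<Rightarrow> 'a) \<Rightarrow> ('y \<Rightarrow> 'b) \<Rightarrow> 'x \<times> 'y \<Rightarrow> 'c"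
  where "tensor_map tens F1 F2 = (\<lambda>(x1, x2). tens (F1 x1) (F2 x2))"

end

theory Submission
  imports Defs
begin

text \<open>Let \<open>F\<close> be a Bessel mapping with a dual \<open>D\<close>, and for a Bessel mapping \<open>W\<close> let
  \<open>R\<^sub>W f = \<integral> \<langle>f, F y\<rangle> W y\<close>. Duality of \<open>F\<close> and \<open>G\<close> says that \<open>R\<^sub>G\<close> is the identity. Thus every dual
  satisfies \<open>G = D + G - R\<^sub>G D\<close>, which is the required form with \<open>W = G\<close>. Conversely, since
  \<open>\<integral> \<langle>f, F y\<rangle> R\<^sub>W (D y) = R\<^sub>W (\<integral> \<langle>f, F y\<rangle> D y) = R\<^sub>W f\<close>, the terms \<open>W\<close> and \<open>R\<^sub>W D\<close> contribute
  opposite amounts, so that \<open>D + W - R\<^sub>W D\<close> is a dual for every Bessel mapping \<open>W\<close>. This is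
  \<open>dual_frames_from_one_dual\<close>.

  For \<open>F = F1 \<otimes> F2\<close> the dual \<open>D\<close> is the tensor product of the canonical duals \<open>S\<^sup>-\<^sup>1 F1\<close> and
  \<open>S\<^sup>-\<^sup>1 F2\<close> of the factors, and \<open>R\<^sub>W (D x)\<close> is the integral in the theorem because the inner product
  of elementary tensors factorises. What
  remains is to see that \<open>F\<close> and \<open>D\<close> are Bessel mappings (\<open>bessel_mapping_tensor_map\<close>, by Tonelli
  and a Gram--Schmidt argument) and dual to each other (\<open>tensor_map_duality\<close>, by Fubini and density
  of the elementary tensors). The lower frame bound of \<open>F\<close> is then a consequence of duality
  (\<open>bessel_duality_imp_frame\<close>).

  The Hilbert space theory behind this is a single variational statement,
  \<open>coercive_symmetric_form_represents\<close>. It yields the Riesz representation theorem, hence the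
  existence of the weak integrals, and the invertibility of frame operators.\<close>

section \<open>Complex inner products\<close>

lemma cinner_add_right: "cinner x (y + z) = cinner x y + cinner x z"
  for x :: "'a::complex_inner"
  by (metis cinner_add_left cinner_commute complex_cnj_add)

lemma cinner_scaleC_right: "cinner x (a *\<^sub>C y) = cnj a * cinner x y"
  for x :: "'a::complex_inner"
  by (metis cinner_commute cinner_scaleC_left complex_cnj_mult)

lemma cinner_self: "cinner x x = of_real ((norm x)\<^sup>2)" for x :: "'a::complex_inner"
proof (rule complex_eqI)
  have "Im (cinner x x) = - Im (cinner x x)"
    using cinner_commute[of x x] by (metis cnj.sel(2))
  then show "Im (cinner x x) = Im (of_real ((norm x)\<^sup>2))" by simp
qed (simp add: inner_eq_Re_cinner[symmetric] power2_norm_eq_inner)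

lemma norm_scaleC: "norm (a *\<^sub>C x) = cmod a * norm x" for x :: "'a::complex_inner"
proof -
  have "complex_of_real ((norm (a *\<^sub>C x))\<^sup>2) = a * cnj a * cinner x x"
    by (simp only: cinner_self[symmetric] cinner_scaleC_left cinner_scaleC_right mult_ac)
  also have "\<dots> = of_real ((cmod a * norm x)\<^sup>2)"
    by (simp add: cinner_self power_mult_distrib complex_mult_cnj cmod_power2 flip: of_real_power)
  finally have "(norm (a *\<^sub>C x))\<^sup>2 = (cmod a * norm x)\<^sup>2"
    using of_real_eq_iff by blast
  then show ?thesis by (simp add: power2_eq_iff_nonneg)
qed

text \<open>The real inner product is only the real part of the complex one. Rotating \<open>x\<close> by the phase of
  \<open>cinner x y\<close> makes that number real, so that the real Cauchy--Schwarz inequality applies.\<close>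

lemma norm_cinner_le: "cmod (cinner x y) \<le> norm x * norm y" for x :: "'a::complex_inner"
proof -
  define u where "u = cnj (sgn (cinner x y))"
  have "of_real (cmod (cinner x y)) = u * cinner x y"
    unfolding u_def
    by (cases "cinner x y = 0")
      (simp_all add: sgn_eq complex_norm_square[symmetric] field_simps power2_eq_square)
  then have "of_real (cmod (cinner x y)) = cinner (u *\<^sub>C x) y"
    by (simp add: cinner_scaleC_left)
  then have "cmod (cinner x y) = inner (u *\<^sub>C x) y"
    by (metis Re_complex_of_real inner_eq_Re_cinner)
  also have "\<dots> \<le> norm (u *\<^sub>C x) * norm y"
    by (rule norm_cauchy_schwarz)
  also have "\<dots> \<le> 1 * norm x * norm y"
    unfolding norm_scaleC by (intro mult_right_mono) (auto simp: u_def norm_sgn)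
  finally show ?thesis by simp
qed

lemma bounded_linear_cinner_left: "bounded_linear (\<lambda>x. cinner x y)"
  by (rule bounded_linear_intro[where K="norm y"])
    (simp_all add: cinner_add_left scaleR_eq_scaleC cinner_scaleC_left norm_cinner_le
      scaleR_conv_of_real scaleC_complex_def)

lemma bounded_linear_cinner_right: "bounded_linear (\<lambda>y. cinner x y)"
  by (rule bounded_linear_intro[where K="norm x"])
    (simp_all add: cinner_add_right scaleR_eq_scaleC cinner_scaleC_right norm_cinner_le
      scaleC_complex_def mult.commute[of _ "norm x"])

lemmas cinner_diff_left = linear_diff[OF bounded_linear.linear[OF bounded_linear_cinner_left]]
lemmas cinner_minus_left = linear_neg[OF bounded_linear.linear[OF bounded_linear_cinner_left]]
lemmas cinner_minus_right = linear_neg[OF bounded_linear.linear[OF bounded_linear_cinner_right]]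
lemmas cinner_sum_left = linear_sum[OF bounded_linear.linear[OF bounded_linear_cinner_left]]
lemmas cinner_sum_right = linear_sum[OF bounded_linear.linear[OF bounded_linear_cinner_right]]
lemmas cinner_zero_left = linear_0[OF bounded_linear.linear[OF bounded_linear_cinner_left]]

lemma cinner_ext:
  assumes "\<And>g. cinner u g = cinner v g"
  shows "u = v"
  using assms[of "u - v"] cinner_diff_left[of u v "u - v"] by (simp add: cinner_self)

section \<open>Representation of bounded functionals\<close>

text \<open>The symmetric Lax--Milgram theorem. It serves twice: with \<open>b = inner\<close> it is the Riesz
  representation theorem, which makes weak integrals exist, and with \<open>b f g = inner (S f) g\<close> it
  solves \<open>S f = h\<close> for the frame operator \<open>S\<close>. The vector \<open>v\<close> is the minimiser of the energy
  \<open>J x = b x x - 2 * \<phi> x\<close>: coercivity bounds \<open>J\<close> below, the parallelogram law makes minimising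
  sequences Cauchy, and the derivative of \<open>J\<close> at a minimiser vanishes in every direction.\<close>

lemma coercive_symmetric_form_represents:
  fixes b :: "'a::{real_inner, complete_space} \<Rightarrow> 'a \<Rightarrow> real"
  assumes "bounded_bilinear b" and sym: "\<And>x y. b x y = b y x"
    and "0 < c" and coercive: "\<And>x. c * (norm x)\<^sup>2 \<le> b x x"
    and "bounded_linear \<phi>"
  obtains v where "\<And>w. b v w = \<phi> w"
proof -
  interpret b: bounded_bilinear b by fact
  interpret \<phi>: bounded_linear \<phi> by fact
  define J where "J x = b x x - 2 * \<phi> x" for x
  obtain K where K: "\<And>x. \<bar>\<phi> x\<bar> \<le> norm x * K"
    using \<phi>.bounded by auto
  have "J x \<ge> - (K\<^sup>2 / c)" for x
  proof -
    have "0 \<le> (c * norm x - K)\<^sup>2 / c"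
      using \<open>0 < c\<close> by simp
    also have "\<dots> = c * (norm x)\<^sup>2 - 2 * (norm x * K) + K\<^sup>2 / c"
      using \<open>0 < c\<close> by (simp add: field_simps power2_eq_square)
    finally show ?thesis
      using coercive[of x] K[of x] by (simp add: J_def)
  qed
  then have bdd: "bdd_below (range J)"
    by (intro bdd_belowI[of _ "- (K\<^sup>2 / c)"]) auto
  define m where "m = Inf (range J)"
  have m_le: "m \<le> J x" for x
    unfolding m_def by (rule cInf_lower[OF _ bdd]) simp
  have "\<exists>x. J x < m + inverse (real (Suc n))" for n
    using cInf_lessD[of "range J" "m + inverse (real (Suc n))"] by (auto simp: m_def)
  then obtain X where X: "\<And>n. J (X n) < m + inverse (real (Suc n))"
    by metis
  \<comment> \<open>The parallelogram law for \<open>b\<close>; the linear part of the energy cancels.\<close>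
  have J_mid: "b (x - y) (x - y) = 2 * J x + 2 * J y - 4 * J ((1/2) *\<^sub>R (x + y))" for x y
    by (simp add: J_def b.add_left b.add_right b.diff_left b.diff_right b.scaleR_left
        b.scaleR_right \<phi>.add \<phi>.scaleR sym[of y x] field_simps)
  have dist_X: "c * (norm (X n - X k))\<^sup>2 \<le> 2 * inverse (real (Suc n)) + 2 * inverse (real (Suc k))"
    for n k
    using coercive[of "X n - X k"] J_mid[of "X n" "X k"] X[of n] X[of k]
      m_le[of "(1/2) *\<^sub>R (X n + X k)"] by linarith
  have "Cauchy X"
  proof (rule CauchyI)
    fix e :: real assume "0 < e"
    then have "0 < c * e\<^sup>2 / 4" using \<open>0 < c\<close> by simp
    then obtain N where N: "inverse (real (Suc N)) < c * e\<^sup>2 / 4"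
      using reals_Archimedean by blast
    have "norm (X n - X k) < e" if "N \<le> n" "N \<le> k" for n k
    proof -
      have "inverse (real (Suc n)) \<le> inverse (real (Suc N))"
        "inverse (real (Suc k)) \<le> inverse (real (Suc N))"
        using that by (auto intro!: le_imp_inverse_le)
      then have "c * (norm (X n - X k))\<^sup>2 < c * e\<^sup>2"
        using dist_X[of n k] N by linarith
      then have "(norm (X n - X k))\<^sup>2 < e\<^sup>2"
        using \<open>0 < c\<close> by simp
      then show ?thesis
        using \<open>0 < e\<close> by (simp add: power2_less_imp_less)
    qed
    then show "\<exists>M. \<forall>m\<ge>M. \<forall>n\<ge>M. norm (X m - X n) < e" by blast
  qed
  then obtain v where v: "X \<longlonglongrightarrow> v"
    using Cauchy_convergent convergent_def by blast
  have "(\<lambda>n. J (X n)) \<longlonglongrightarrow> J v"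
    unfolding J_def by (intro tendsto_intros b.tendsto \<phi>.tendsto v)
  moreover have "(\<lambda>n. m + inverse (real (Suc n))) \<longlonglongrightarrow> m"
    using tendsto_add[OF tendsto_const LIMSEQ_inverse_real_of_nat, of m] by simp
  ultimately have "J v \<le> m"
    using X by (intro LIMSEQ_le) (auto intro: less_imp_le)
  have "b v w = \<phi> w" for w
  proof (rule ccontr)
    define d where "d = b v w - \<phi> w"
    define q where "q = b w w"
    \<comment> \<open>Any step against the slope \<open>d\<close> that is short compared with the curvature \<open>q\<close> lowers the
      energy; the \<open>+ 1\<close> covers a vanishing curvature.\<close>
    define t where "t = - d / (q + 1)"
    assume "b v w \<noteq> \<phi> w"
    then have "d \<noteq> 0" by (simp add: d_def)
    have "0 \<le> q"
      using coercive[of w] \<open>0 < c\<close> by (simp add: q_def) (metis mult_nonneg_nonneg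
          less_imp_le order_trans zero_le_power2)
    have "J v \<le> J (v + t *\<^sub>R w)"
      using \<open>J v \<le> m\<close> m_le order_trans by blast
    also have "\<dots> = J v + 2 * t * d + t\<^sup>2 * q"
      by (simp add: J_def d_def q_def b.add_left b.add_right b.scaleR_left b.scaleR_right
          \<phi>.add \<phi>.scaleR sym[of w v] algebra_simps power2_eq_square)
    finally have "0 \<le> 2 * t * d + t\<^sup>2 * q" by simp
    also have "\<dots> = - (d\<^sup>2 * (q + 2) / (q + 1)\<^sup>2)"
      using \<open>0 \<le> q\<close> by (simp add: t_def field_simps power2_eq_square add_nonneg_eq_0_iff)
    also have "\<dots> < 0"
      using \<open>d \<noteq> 0\<close> \<open>0 \<le> q\<close> by (simp add: add_nonneg_pos)
    finally show False by simp
  qed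
  then show thesis by (rule that)
qed

text \<open>The real theorem represents the real part of \<open>\<phi>\<close>; replacing \<open>g\<close> by \<open>\<i> *\<^sub>C g\<close> turns the
  equality of real parts into that of imaginary parts.\<close>

lemma riesz_representation:
  fixes \<phi> :: "'a::complex_hilbert \<Rightarrow> complex"
  assumes add: "\<And>g h. \<phi> (g + h) = \<phi> g + \<phi> h"
    and conj: "\<And>a g. \<phi> (a *\<^sub>C g) = cnj a * \<phi> g"
    and bound: "\<And>g. cmod (\<phi> g) \<le> K * norm g"
  obtains v where "\<And>g. cinner v g = \<phi> g"
proof -
  have "bounded_linear (\<lambda>g. Re (\<phi> g))"
  proof (rule bounded_linear_intro[where K=K])
    show "norm (Re (\<phi> g)) \<le> norm g * K" for g
      using bound[of g] abs_Re_le_cmod[of "\<phi> g"] by (simp add: mult.commute)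
  qed (simp_all add: add conj scaleR_eq_scaleC)
  then obtain v where "\<And>g. inner v g = Re (\<phi> g)"
    using coercive_symmetric_form_represents[OF bounded_bilinear_inner inner_commute, of 1]
    by (auto simp: power2_norm_eq_inner)
  then have Re: "Re (cinner v g) = Re (\<phi> g)" for g
    by (simp add: inner_eq_Re_cinner)
  have "Im (cinner v g) = Im (\<phi> g)" for g
    using Re[of "\<i> *\<^sub>C g"] by (simp add: cinner_scaleC_right conj)
  with Re have "cinner v g = \<phi> g" for g
    by (simp add: complex_eqI)
  then show thesis by (rule that)
qed

section \<open>Weak integrals and Bessel mappings\<close>

lemma L2_pairing:
  fixes u v :: "'x \<Rightarrow> complex"
  assumes [measurable]: "u \<in> borel_measurable M" "v \<in> borel_measurable M"
    and u: "(\<integral>\<^sup>+ x. ennreal ((cmod (u x))\<^sup>2) \<partial>M) \<le> ennreal (a\<^sup>2)"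
    and v: "(\<integral>\<^sup>+ x. ennreal ((cmod (v x))\<^sup>2) \<partial>M) \<le> ennreal (b\<^sup>2)"
    and "0 \<le> a" "0 \<le> b"
  shows "integrable M (\<lambda>x. u x * v x)" and "cmod (\<integral> x. u x * v x \<partial>M) \<le> a * b"
proof -
  let ?I = "\<integral>\<^sup>+ x. ennreal (norm (u x * v x)) \<partial>M"
  have "?I\<^sup>2 = (\<integral>\<^sup>+ x. ennreal (cmod (u x)) * ennreal (cmod (v x)) \<partial>M)\<^sup>2"
    by (simp add: norm_mult ennreal_mult)
  also have "\<dots> \<le> (\<integral>\<^sup>+ x. (ennreal (cmod (u x)))\<^sup>2 \<partial>M) * (\<integral>\<^sup>+ x. (ennreal (cmod (v x)))\<^sup>2 \<partial>M)"
    by (rule Cauchy_Schwarz_nn_integral) measurable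
  also have "\<dots> \<le> ennreal (a\<^sup>2) * ennreal (b\<^sup>2)"
    using u v by (intro mult_mono) (simp_all add: ennreal_power)
  also have "\<dots> = (ennreal (a * b))\<^sup>2"
    using \<open>0 \<le> a\<close> \<open>0 \<le> b\<close> by (simp add: ennreal_power ennreal_mult[symmetric] power_mult_distrib)
  finally have I: "?I \<le> ennreal (a * b)"
    using \<open>0 \<le> a\<close> \<open>0 \<le> b\<close>
    by (cases ?I rule: ennreal_cases) (auto simp: ennreal_power power2_le_iff_abs_le top_unique)
  show int: "integrable M (\<lambda>x. u x * v x)"
    using I by (intro integrableI_bounded) (auto simp: le_less_trans)
  have "ennreal (cmod (\<integral> x. u x * v x \<partial>M)) \<le> ?I"
    by (rule integral_norm_bound_ennreal[OF int])
  with I have "ennreal (cmod (\<integral> x. u x * v x \<partial>M)) \<le> ennreal (a * b)" by (rule order_trans[rotated])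
  then show "cmod (\<integral> x. u x * v x \<partial>M) \<le> a * b"
    using \<open>0 \<le> a\<close> \<open>0 \<le> b\<close> by simp
qed

lemma has_weak_integral_unique:
  assumes "has_weak_integral M h v" "has_weak_integral M h w"
  shows "v = w"
proof (rule cinner_ext)
  show "cinner v g = cinner w g" for g
    using assms unfolding has_weak_integral_def
    by (intro has_bochner_integral_eq[of M "\<lambda>x. cinner (h x) g"]) auto
qed

lemma weak_integral_eq:
  assumes "has_weak_integral M h v"
  shows "weak_integral M h = v"
  unfolding weak_integral_def
  by (rule the_equality[of "has_weak_integral M h", OF assms has_weak_integral_unique[OF _ assms]])

lemma weakly_measurableD:
  assumes "weakly_measurable M F"
  shows "(\<lambda>x. cinner f (F x)) \<in> borel_measurable M"
    and "(\<lambda>x. cinner (F x) f) \<in> borel_measurable M"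
proof -
  show *: "(\<lambda>x. cinner f (F x)) \<in> borel_measurable M"
    using assms by (simp add: weakly_measurable_def)
  have "(\<lambda>x. cnj (cinner f (F x))) \<in> borel_measurable M"
    using * by (rule borel_measurable_continuous_on[OF continuous_on_cnj[OF continuous_on_id]])
  then show "(\<lambda>x. cinner (F x) f) \<in> borel_measurable M"
    by (simp flip: cinner_commute)
qed

lemma bessel_mappingI:
  assumes "weakly_measurable M F"
    and "\<And>f. (\<integral>\<^sup>+ x. ennreal ((cmod (cinner f (F x)))\<^sup>2) \<partial>M) \<le> ennreal ((C * norm f)\<^sup>2)"
  shows "bessel_mapping M F"
  using assms unfolding bessel_mapping_def
  by (auto intro!: exI[of _ "C\<^sup>2"] simp: power_mult_distrib)

lemma bessel_mappingE:
  assumes "bessel_mapping M F"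
  obtains C where "0 \<le> C" "weakly_measurable M F"
    and "\<And>f. (\<integral>\<^sup>+ x. ennreal ((cmod (cinner f (F x)))\<^sup>2) \<partial>M) \<le> ennreal ((C * norm f)\<^sup>2)"
proof -
  obtain B where B: "\<And>f. (\<integral>\<^sup>+ x. ennreal ((cmod (cinner f (F x)))\<^sup>2) \<partial>M) \<le> ennreal (B * (norm f)\<^sup>2)"
    using assms by (auto simp: bessel_mapping_def)
  have "B * (norm f)\<^sup>2 \<le> (sqrt \<bar>B\<bar> * norm f)\<^sup>2" for f :: 'b
    by (simp add: power_mult_distrib mult_right_mono)
  then have "(\<integral>\<^sup>+ x. ennreal ((cmod (cinner f (F x)))\<^sup>2) \<partial>M) \<le> ennreal ((sqrt \<bar>B\<bar> * norm f)\<^sup>2)" for f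
    using B[of f] by (meson ennreal_leI order_trans)
  with assms show thesis
    by (intro that[of "sqrt \<bar>B\<bar>"]) (auto simp: bessel_mapping_def)
qed

lemma bessel_pairing:
  assumes "bessel_mapping M P" "bessel_mapping M Q"
  obtains K where "0 \<le> K"
    and "\<And>f g. integrable M (\<lambda>x. cinner f (P x) * cinner (Q x) g)"
    and "\<And>f g. cmod (\<integral> x. cinner f (P x) * cinner (Q x) g \<partial>M) \<le> K * norm f * norm g"
proof -
  obtain C where C: "0 \<le> C" "weakly_measurable M P"
    "\<And>f. (\<integral>\<^sup>+ x. ennreal ((cmod (cinner f (P x)))\<^sup>2) \<partial>M) \<le> ennreal ((C * norm f)\<^sup>2)"
    by (rule bessel_mappingE[OF assms(1)]) (rule that)
  obtain D where D: "0 \<le> D" "weakly_measurable M Q"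
    "\<And>f. (\<integral>\<^sup>+ x. ennreal ((cmod (cinner f (Q x)))\<^sup>2) \<partial>M) \<le> ennreal ((D * norm f)\<^sup>2)"
    by (rule bessel_mappingE[OF assms(2)]) (rule that)
  have D': "(\<integral>\<^sup>+ x. ennreal ((cmod (cinner (Q x) g))\<^sup>2) \<partial>M) \<le> ennreal ((D * norm g)\<^sup>2)" for g
    using D(3)[of g] by (metis (no_types, lifting) cinner_commute complex_mod_cnj nn_integral_cong)
  note pairing = L2_pairing[OF weakly_measurableD(1)[OF C(2)] weakly_measurableD(2)[OF D(2)]
      C(3) D' mult_nonneg_nonneg[OF C(1) norm_ge_zero] mult_nonneg_nonneg[OF D(1) norm_ge_zero]]
  show thesis
    by (rule that[of "C * D"]) (use pairing C(1) D(1) in \<open>auto simp: mult_ac\<close>)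
qed

lemma bessel_mapping_add:
  assumes "bessel_mapping M P" "bessel_mapping M Q"
  shows "bessel_mapping M (\<lambda>x. P x + Q x)"
proof -
  obtain C where C: "0 \<le> C" "weakly_measurable M P"
    "\<And>f. (\<integral>\<^sup>+ x. ennreal ((cmod (cinner f (P x)))\<^sup>2) \<partial>M) \<le> ennreal ((C * norm f)\<^sup>2)"
    by (rule bessel_mappingE[OF assms(1)]) (rule that)
  obtain D where D: "0 \<le> D" "weakly_measurable M Q"
    "\<And>f. (\<integral>\<^sup>+ x. ennreal ((cmod (cinner f (Q x)))\<^sup>2) \<partial>M) \<le> ennreal ((D * norm f)\<^sup>2)"
    by (rule bessel_mappingE[OF assms(2)]) (rule that)
  note [measurable] = weakly_measurableD(1)[OF C(2)] weakly_measurableD(1)[OF D(2)]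
  show ?thesis
  proof (rule bessel_mappingI[where C="sqrt (2 * C\<^sup>2 + 2 * D\<^sup>2)"])
    show "weakly_measurable M (\<lambda>x. P x + Q x)"
      unfolding weakly_measurable_def cinner_add_right by measurable
    fix f
    have sq: "(cmod (u + v))\<^sup>2 \<le> 2 * (cmod u)\<^sup>2 + 2 * (cmod v)\<^sup>2" for u v
    proof -
      have "(cmod (u + v))\<^sup>2 \<le> (cmod u + cmod v)\<^sup>2"
        by (intro power_mono norm_triangle_ineq norm_ge_zero)
      also have "\<dots> \<le> 2 * (cmod u)\<^sup>2 + 2 * (cmod v)\<^sup>2"
        using sum_squares_bound[of "cmod u" "cmod v"] by (simp add: power2_sum)
      finally show ?thesis .
    qed
    have "(\<integral>\<^sup>+ x. ennreal ((cmod (cinner f (P x + Q x)))\<^sup>2) \<partial>M)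
      \<le> (\<integral>\<^sup>+ x. 2 * ennreal ((cmod (cinner f (P x)))\<^sup>2) + 2 * ennreal ((cmod (cinner f (Q x)))\<^sup>2) \<partial>M)"
      unfolding cinner_add_right
      by (intro nn_integral_mono order_trans[OF ennreal_leI[OF sq]])
        (simp add: ennreal_plus ennreal_mult)
    also have "\<dots> = 2 * (\<integral>\<^sup>+ x. ennreal ((cmod (cinner f (P x)))\<^sup>2) \<partial>M)
        + 2 * (\<integral>\<^sup>+ x. ennreal ((cmod (cinner f (Q x)))\<^sup>2) \<partial>M)"
      by (simp add: nn_integral_add nn_integral_cmult)
    also have "\<dots> \<le> 2 * ennreal ((C * norm f)\<^sup>2) + 2 * ennreal ((D * norm f)\<^sup>2)"
      by (intro add_mono mult_left_mono C D) auto
    also have "\<dots> = ennreal ((sqrt (2 * C\<^sup>2 + 2 * D\<^sup>2) * norm f)\<^sup>2)"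
      by (simp add: power_mult_distrib ennreal_plus ennreal_mult distrib_right mult.assoc)
    finally show "(\<integral>\<^sup>+ x. ennreal ((cmod (cinner f (P x + Q x)))\<^sup>2) \<partial>M)
      \<le> ennreal ((sqrt (2 * C\<^sup>2 + 2 * D\<^sup>2) * norm f)\<^sup>2)" .
  qed
qed

text \<open>Since \<open>cinner f (T (P x)) = cinner (T' f) (P x)\<close>, the Bessel integral
  of \<open>T \<circ> P\<close> at \<open>f\<close> is that of \<open>P\<close> at \<open>T' f\<close>.\<close>

lemma bessel_mapping_image:
  assumes "bessel_mapping M P" and adj: "\<And>f g. cinner f (T g) = cinner (T' f) g"
    and bound: "\<And>f. norm (T' f) \<le> K * norm f"
  shows "bessel_mapping M (\<lambda>x. T (P x))"
proof -
  obtain C where C: "0 \<le> C" "weakly_measurable M P"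
    "\<And>f. (\<integral>\<^sup>+ x. ennreal ((cmod (cinner f (P x)))\<^sup>2) \<partial>M) \<le> ennreal ((C * norm f)\<^sup>2)"
    by (rule bessel_mappingE[OF assms(1)]) (rule that)
  show ?thesis
  proof (rule bessel_mappingI[where C="C * K"])
    show "weakly_measurable M (\<lambda>x. T (P x))"
      unfolding weakly_measurable_def adj using weakly_measurableD(1)[OF C(2)] by blast
    fix f
    have "(C * norm (T' f))\<^sup>2 \<le> (C * K * norm f)\<^sup>2"
      using mult_left_mono[OF bound[of f] C(1)] C(1) by (intro power_mono) (auto simp: mult.assoc)
    then show "(\<integral>\<^sup>+ x. ennreal ((cmod (cinner f (T (P x))))\<^sup>2) \<partial>M) \<le> ennreal ((C * K * norm f)\<^sup>2)"
      unfolding adj using C(3)[of "T' f"] by (meson ennreal_leI order_trans)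
  qed
qed

section \<open>Mixed frame operators and duality\<close>

text \<open>The composition of the analysis operator of \<open>P\<close> with the synthesis operator of \<open>Q\<close>, without the
  detour through an \<open>L\<^sup>2\<close> space. It is the frame operator if \<open>P = Q\<close>, it is the identity exactly if
  \<open>Q\<close> reconstructs from the coefficients with respect to \<open>P\<close>, and the integral that is subtracted
  in the description of the dual frames is one of its values.\<close>

definition mixed_frame_operator ::
  "'x measure \<Rightarrow> ('x \<Rightarrow> 'a::complex_hilbert) \<Rightarrow> ('x \<Rightarrow> 'a) \<Rightarrow> 'a \<Rightarrow> 'a"
  where "mixed_frame_operator M P Q f = weak_integral M (\<lambda>x. cinner f (P x) *\<^sub>C Q x)"

context
  fixes M :: "'x measure" and P Q :: "'x \<Rightarrow> 'a::complex_hilbert"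
  assumes P: "bessel_mapping M P" and Q: "bessel_mapping M Q"
begin

text \<open>The weak integral exists since, by the Cauchy--Schwarz inequality in \<open>L\<^sup>2\<close>, it is a bounded
  conjugate-linear functional of \<open>g\<close>.\<close>

lemma mixed_frame_operator_has_integral:
  "has_bochner_integral M (\<lambda>x. cinner f (P x) * cinner (Q x) g)
     (cinner (mixed_frame_operator M P Q f) g)"
proof -
  obtain K where K: "0 \<le> K"
    "\<And>f g. integrable M (\<lambda>x. cinner f (P x) * cinner (Q x) g)"
    "\<And>f g. cmod (\<integral> x. cinner f (P x) * cinner (Q x) g \<partial>M) \<le> K * norm f * norm g"
    by (rule bessel_pairing[OF P Q]) (rule that)
  define \<phi> where "\<phi> g = (\<integral> x. cinner f (P x) * cinner (Q x) g \<partial>M)" for g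
  have "\<phi> (g + h) = \<phi> g + \<phi> h" for g h
    using K(2) by (simp add: \<phi>_def cinner_add_right ring_distribs)
  moreover have "\<phi> (a *\<^sub>C g) = cnj a * \<phi> g" for a g
    by (simp add: \<phi>_def cinner_scaleC_right mult.left_commute)
  moreover have "cmod (\<phi> g) \<le> (K * norm f) * norm g" for g
    unfolding \<phi>_def by (rule K(3))
  ultimately obtain v where v: "\<And>g. cinner v g = \<phi> g"
    by (rule riesz_representation) (rule that)
  have hwi: "has_weak_integral M (\<lambda>x. cinner f (P x) *\<^sub>C Q x) v"
    using K(2) by (simp add: has_weak_integral_def v \<phi>_def cinner_scaleC_left
        has_bochner_integral_integrable)
  then show ?thesis
    unfolding mixed_frame_operator_def weak_integral_eq[OF hwi]
    by (simp add: has_weak_integral_def cinner_scaleC_left)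
qed

lemma bounded_linear_mixed_frame_operator: "bounded_linear (mixed_frame_operator M P Q)"
proof -
  let ?R = "mixed_frame_operator M P Q"
  note int = mixed_frame_operator_has_integral
  obtain K where K: "0 \<le> K"
    "\<And>f g. integrable M (\<lambda>x. cinner f (P x) * cinner (Q x) g)"
    "\<And>f g. cmod (\<integral> x. cinner f (P x) * cinner (Q x) g \<partial>M) \<le> K * norm f * norm g"
    by (rule bessel_pairing[OF P Q]) (rule that)
  show ?thesis
  proof (rule bounded_linear_intro[where K=K])
    show "?R (f + f') = ?R f + ?R f'" for f f'
    proof (rule cinner_ext)
      show "cinner (?R (f + f')) g = cinner (?R f + ?R f') g" for g
        using has_bochner_integral_add[OF int[of f g] int[of f' g]]
        by (intro has_bochner_integral_eq[OF int[of "f + f'" g]])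
          (simp add: cinner_add_left distrib_right)
    qed
    show "?R (r *\<^sub>R f) = r *\<^sub>R ?R f" for r f
    proof (rule cinner_ext)
      show "cinner (?R (r *\<^sub>R f)) g = cinner (r *\<^sub>R ?R f) g" for g
        using has_bochner_integral_mult_right[OF int[of f g], of "of_real r"]
        by (intro has_bochner_integral_eq[OF int[of "r *\<^sub>R f" g]])
          (simp add: scaleR_eq_scaleC cinner_scaleC_left mult.assoc)
    qed
    show "norm (?R f) \<le> norm f * K" for f
    proof (cases "?R f = 0")
      case False
      have "(norm (?R f))\<^sup>2 = cmod (cinner (?R f) (?R f))"
        by (simp add: cinner_self norm_power)
      also have "\<dots> \<le> K * norm f * norm (?R f)"
        using K(3)[of f "?R f"] has_bochner_integral_integral_eq[OF int[of f "?R f"]] by simp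
      finally show ?thesis
        using False by (simp add: power2_eq_square mult.commute)
    qed (use K(1) in simp)
  qed
qed

end

lemma mixed_frame_operator_adjoint:
  assumes "bessel_mapping M P" "bessel_mapping M Q"
  shows "cinner (mixed_frame_operator M P Q f) g = cinner f (mixed_frame_operator M Q P g)"
proof -
  have "has_bochner_integral M (\<lambda>x. cnj (cinner g (Q x) * cinner (P x) f))
      (cnj (cinner (mixed_frame_operator M Q P g) f))"
    by (intro has_bochner_integral_bounded_linear[OF bounded_linear_cnj]
        mixed_frame_operator_has_integral assms)
  then have "has_bochner_integral M (\<lambda>x. cinner f (P x) * cinner (Q x) g)
      (cinner f (mixed_frame_operator M Q P g))"
    by (simp add: cinner_commute[symmetric] mult.commute)
  then show ?thesis
    by (rule has_bochner_integral_eq[OF mixed_frame_operator_has_integral[OF assms]])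
qed

lemma mixed_frame_operator_bounded:
  assumes "bessel_mapping M P" "bessel_mapping M Q"
  obtains K where "\<And>f. norm (mixed_frame_operator M P Q f) \<le> K * norm f"
  using bounded_linear.bounded[OF bounded_linear_mixed_frame_operator[OF assms]]
  by (metis mult.commute)

text \<open>Duality turns the upper bound of \<open>G\<close> into a lower bound of \<open>F\<close>: the square of \<open>norm f\<close> is the
  \<open>L\<^sup>2\<close> pairing of the coefficients of \<open>f\<close> with respect to \<open>F\<close> and \<open>G\<close>, and the norm of the latter
  is at most a multiple of \<open>norm f\<close>.\<close>

lemma bessel_duality_imp_frame:
  assumes F: "bessel_mapping M F" and G: "bessel_mapping M G"
    and dual: "mixed_frame_operator M F G = (\<lambda>f. f)"
  shows "continuous_frame M F"
proof -
  obtain C where C: "0 \<le> C" "weakly_measurable M F"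
    "\<And>f. (\<integral>\<^sup>+ x. ennreal ((cmod (cinner f (F x)))\<^sup>2) \<partial>M) \<le> ennreal ((C * norm f)\<^sup>2)"
    by (rule bessel_mappingE[OF F]) (rule that)
  obtain D where D: "0 \<le> D" "weakly_measurable M G"
    "\<And>f. (\<integral>\<^sup>+ x. ennreal ((cmod (cinner f (G x)))\<^sup>2) \<partial>M) \<le> ennreal ((D * norm f)\<^sup>2)"
    by (rule bessel_mappingE[OF G]) (rule that)
  have D': "(\<integral>\<^sup>+ x. ennreal ((cmod (cinner (G x) g))\<^sup>2) \<partial>M) \<le> ennreal ((D * norm g)\<^sup>2)" for g
    using D(3)[of g] by (metis (no_types, lifting) cinner_commute complex_mod_cnj nn_integral_cong)
  \<comment> \<open>The \<open>+ 1\<close> keeps the denominator positive when \<open>D = 0\<close>, as is possible on the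
    zero space.\<close>
  have lower: "ennreal (1 / (D\<^sup>2 + 1) * (norm f)\<^sup>2)
      \<le> (\<integral>\<^sup>+ x. ennreal ((cmod (cinner f (F x)))\<^sup>2) \<partial>M)" (is "_ \<le> ?I") for f
  proof (cases "f = 0")
    case False
    have "?I < \<infinity>"
      using C(3)[of f] by (rule le_less_trans) simp
    then obtain s where s: "0 \<le> s" "?I = ennreal s"
      by (cases ?I rule: ennreal_cases) auto
    have I: "?I \<le> ennreal ((sqrt s)\<^sup>2)" using s by simp
    have "(norm f)\<^sup>2 = cmod (cinner f f)"
      by (simp add: cinner_self norm_power)
    also have "\<dots> = cmod (\<integral> x. cinner f (F x) * cinner (G x) f \<partial>M)"
      using has_bochner_integral_integral_eq[OF mixed_frame_operator_has_integral[OF F G, of f f]]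
      by (simp add: dual)
    also have "\<dots> \<le> sqrt s * (D * norm f)"
      by (rule L2_pairing(2)[OF weakly_measurableD(1)[OF C(2)] weakly_measurableD(2)[OF D(2)] I D'])
        (use s D(1) in auto)
    finally have "norm f \<le> sqrt s * D"
      using False by (simp add: power2_eq_square flip: mult.assoc)
    then have "(norm f)\<^sup>2 \<le> s * D\<^sup>2"
      using power_mono[of "norm f" "sqrt s * D" 2] s(1) by (simp add: power_mult_distrib)
    also have "\<dots> \<le> s * (D\<^sup>2 + 1)"
      using s(1) by (intro mult_left_mono) auto
    finally have "1 / (D\<^sup>2 + 1) * (norm f)\<^sup>2 \<le> s"
      by (simp add: divide_le_eq add_nonneg_pos)
    then show ?thesis
      unfolding s(2) by (rule ennreal_leI)
  qed simp
  have upper: "(\<integral>\<^sup>+ x. ennreal ((cmod (cinner f (F x)))\<^sup>2) \<partial>M) \<le> ennreal (C\<^sup>2 * (norm f)\<^sup>2)" for f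
    using C(3)[of f] by (simp add: power_mult_distrib)
  have "0 < 1 / (D\<^sup>2 + 1)"
    by (simp add: add_nonneg_pos)
  with C(2) lower upper show ?thesis
    unfolding continuous_frame_def by blast
qed

lemma continuous_frame_bessel: "continuous_frame M F \<Longrightarrow> bessel_mapping M F"
  by (auto simp: continuous_frame_def bessel_mapping_def)

text \<open>The lower frame bound of a dual comes for free: taking adjoints shows that \<open>F\<close> is dual to \<open>G\<close>,
  so that the upper bound of \<open>F\<close> yields the lower bound of \<open>G\<close>.\<close>

lemma dual_frame_iff:
  assumes F: "bessel_mapping M F"
  shows "dual_frame M F G \<longleftrightarrow> bessel_mapping M G \<and> mixed_frame_operator M F G = (\<lambda>f. f)"
proof (intro iffI conjI)
  assume dual: "dual_frame M F G"
  then show G: "bessel_mapping M G"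
    by (simp add: dual_frame_def continuous_frame_bessel)
  show "mixed_frame_operator M F G = (\<lambda>f. f)"
  proof (rule ext, rule cinner_ext)
    show "cinner (mixed_frame_operator M F G f) g = cinner f g" for f g
      using dual unfolding dual_frame_def
      by (intro has_bochner_integral_eq[OF mixed_frame_operator_has_integral[OF F G]]) blast
  qed
next
  assume *: "bessel_mapping M G \<and> mixed_frame_operator M F G = (\<lambda>f. f)"
  have "mixed_frame_operator M G F = (\<lambda>f. f)"
  proof (rule ext, rule cinner_ext)
    show "cinner (mixed_frame_operator M G F f) g = cinner f g" for f g
      using mixed_frame_operator_adjoint[of M G F f g] * F by simp
  qed
  then have "continuous_frame M G"
    using * F bessel_duality_imp_frame by blast
  then show "dual_frame M F G"
    using * mixed_frame_operator_has_integral[OF F, of G] by (simp add: dual_frame_def)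
qed

lemma bessel_mapping_cong:
  assumes "\<And>x. x \<in> space M \<Longrightarrow> F x = G x"
  shows "bessel_mapping M F \<longleftrightarrow> bessel_mapping M G"
proof -
  have "(\<lambda>x. cinner f (F x)) \<in> borel_measurable M \<longleftrightarrow> (\<lambda>x. cinner f (G x)) \<in> borel_measurable M" for f
    using assms by (intro measurable_cong) simp
  moreover have "(\<integral>\<^sup>+ x. ennreal ((cmod (cinner f (F x)))\<^sup>2) \<partial>M)
      = (\<integral>\<^sup>+ x. ennreal ((cmod (cinner f (G x)))\<^sup>2) \<partial>M)" for f
    using assms by (intro nn_integral_cong) simp
  ultimately show ?thesis
    by (simp add: bessel_mapping_def weakly_measurable_def)
qed

text \<open>All duals from one dual \<open>D\<close>. Write \<open>R\<close> for the mixed operator of \<open>F\<close> and \<open>W\<close>. If \<open>G\<close> is a dual,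
  then \<open>R\<close> is the identity for \<open>W = G\<close>, and the formula collapses to \<open>G\<close>. Conversely the mixed
  operator of \<open>F\<close> and \<open>x \<mapsto> R (D x)\<close> is \<open>R\<close> applied to that of \<open>F\<close> and \<open>D\<close>, hence again \<open>R\<close>, and
  cancels the contribution of \<open>W\<close>.\<close>

lemma dual_frames_from_one_dual:
  assumes F: "bessel_mapping M F" and D: "bessel_mapping M D"
    and dual: "mixed_frame_operator M F D = (\<lambda>f. f)"
  shows "dual_frame M F G \<longleftrightarrow> (\<exists>W. bessel_mapping M W \<and>
    (\<forall>x \<in> space M. G x = D x + W x - mixed_frame_operator M F W (D x)))"
proof
  assume "dual_frame M F G"
  then have "bessel_mapping M G" "mixed_frame_operator M F G = (\<lambda>f. f)"
    by (simp_all add: dual_frame_iff[OF F])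
  then show "\<exists>W. bessel_mapping M W \<and>
    (\<forall>x \<in> space M. G x = D x + W x - mixed_frame_operator M F W (D x))"
    by (intro exI[of _ G]) simp
next
  assume "\<exists>W. bessel_mapping M W \<and>
    (\<forall>x \<in> space M. G x = D x + W x - mixed_frame_operator M F W (D x))"
  then obtain W where W: "bessel_mapping M W"
    and G: "\<And>x. x \<in> space M \<Longrightarrow> G x = D x + W x - mixed_frame_operator M F W (D x)"
    by blast
  define R where "R = mixed_frame_operator M F W"
  define R' where "R' = mixed_frame_operator M W F"
  have adj: "cinner (R f) g = cinner f (R' g)" for f g
    unfolding R_def R'_def by (rule mixed_frame_operator_adjoint[OF F W])
  obtain K where K: "\<And>f. norm (R' f) \<le> K * norm f"
    by (rule mixed_frame_operator_bounded[OF W F, folded R'_def]) (rule that)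
  have "bessel_mapping M (\<lambda>x. - R (D x))"
  proof (rule bessel_mapping_image[OF D])
    show "cinner f (- R g) = cinner (- R' f) g" for f g
      using adj[of g f] by (subst (1 2) cinner_commute) (simp add: cinner_minus_left cinner_minus_right)
    show "norm (- R' f) \<le> K * norm f" for f
      using K by simp
  qed
  from bessel_mapping_add[OF bessel_mapping_add[OF D W] this]
  have "bessel_mapping M (\<lambda>x. D x + W x - R (D x))"
    by simp
  moreover have "bessel_mapping M G \<longleftrightarrow> bessel_mapping M (\<lambda>x. D x + W x - R (D x))"
    by (rule bessel_mapping_cong) (simp add: G R_def)
  ultimately have Bessel: "bessel_mapping M G"
    by blast
  have "mixed_frame_operator M F G = (\<lambda>f. f)"
  proof (rule ext, rule cinner_ext)
    fix f g
    have "has_bochner_integral M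
       (\<lambda>x. cinner f (F x) * cinner (D x) g + cinner f (F x) * cinner (W x) g
          - cinner f (F x) * cinner (D x) (R' g))
       (cinner (mixed_frame_operator M F D f) g + cinner (R f) g
          - cinner (mixed_frame_operator M F D f) (R' g))"
      unfolding R_def
      by (rule has_bochner_integral_diff has_bochner_integral_add
          mixed_frame_operator_has_integral F D W)+
    also have "cinner (mixed_frame_operator M F D f) g + cinner (R f) g
          - cinner (mixed_frame_operator M F D f) (R' g) = cinner f g"
      by (simp add: adj dual)
    finally have "has_bochner_integral M (\<lambda>x. cinner f (F x) * cinner (G x) g) (cinner f g)"
      by (rule has_bochner_integral_cong[THEN iffD1, rotated -1])
        (simp_all add: G R_def[symmetric] cinner_add_left cinner_diff_left adj algebra_simps)
    then show "cinner (mixed_frame_operator M F G f) g = cinner f g"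
      by (rule has_bochner_integral_eq[OF mixed_frame_operator_has_integral[OF F Bessel]])
  qed
  with Bessel show "dual_frame M F G"
    by (simp add: dual_frame_iff[OF F])
qed

section \<open>The canonical dual frame\<close>

context
  fixes M :: "'x measure" and F :: "'x \<Rightarrow> 'a::complex_hilbert"
  assumes F: "continuous_frame M F"
begin

lemma frame_operator_eq_mixed: "frame_operator M F = mixed_frame_operator M F F"
  by (intro ext) (simp add: frame_operator_def mixed_frame_operator_def)

lemma frame_operator_coercive:
  obtains A where "0 < A" "\<And>f. A * (norm f)\<^sup>2 \<le> inner (frame_operator M F f) f"
proof -
  obtain A where A: "0 < A"
    "\<And>f. ennreal (A * (norm f)\<^sup>2) \<le> (\<integral>\<^sup>+ x. ennreal ((cmod (cinner f (F x)))\<^sup>2) \<partial>M)"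
    using F by (auto simp: continuous_frame_def)
  have "A * (norm f)\<^sup>2 \<le> inner (frame_operator M F f) f" for f
  proof -
    have "has_bochner_integral M (\<lambda>x. Re (cinner f (F x) * cinner (F x) f))
        (Re (cinner (frame_operator M F f) f))"
      unfolding frame_operator_eq_mixed
      by (intro has_bochner_integral_bounded_linear[OF bounded_linear_Re]
          mixed_frame_operator_has_integral continuous_frame_bessel F)
    also have "(\<lambda>x. Re (cinner f (F x) * cinner (F x) f)) = (\<lambda>x. (cmod (cinner f (F x)))\<^sup>2)"
      by (subst cinner_commute[of _ f]) (simp add: complex_mult_cnj cmod_power2 flip: of_real_power)
    finally have *: "has_bochner_integral M (\<lambda>x. (cmod (cinner f (F x)))\<^sup>2)
        (inner (frame_operator M F f) f)"
      by (simp add: inner_eq_Re_cinner)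
    then have "(\<integral>\<^sup>+ x. ennreal ((cmod (cinner f (F x)))\<^sup>2) \<partial>M)
        = ennreal (inner (frame_operator M F f) f)"
      by (simp add: has_bochner_integral_iff nn_integral_eq_integral)
    moreover have "0 \<le> inner (frame_operator M F f) f"
      by (subst has_bochner_integral_integral_eq[OF *, symmetric]) simp
    ultimately show ?thesis
      using A(2)[of f] by simp
  qed
  with A(1) show thesis by (rule that)
qed

lemma frame_operator_self_adjoint:
  "cinner (frame_operator M F f) g = cinner f (frame_operator M F g)"
  unfolding frame_operator_eq_mixed
  by (intro mixed_frame_operator_adjoint continuous_frame_bessel F)

text \<open>The lower frame bound says that the frame operator is coercive. Hence it is injective, and its
  quadratic form represents every functional \<open>inner h\<close>, which is surjectivity.\<close>

lemma bij_frame_operator: "bij (frame_operator M F)"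
proof (rule bijI)
  let ?S = "frame_operator M F"
  obtain A where A: "0 < A" "\<And>f. A * (norm f)\<^sup>2 \<le> inner (?S f) f"
    by (rule frame_operator_coercive) (rule that)
  interpret S: bounded_linear ?S
    unfolding frame_operator_eq_mixed
    by (intro bounded_linear_mixed_frame_operator continuous_frame_bessel F)
  have "f = 0" if "?S f = 0" for f
    using A(2)[of f] A(1) that by (simp add: mult_le_0_iff)
  then show "inj ?S"
    by (simp add: linear_injective_0[OF S.linear_axioms])
  show "surj ?S"
    unfolding surj_def
  proof
    fix h
    have bil: "bounded_bilinear (\<lambda>f g. inner (?S f) g)"
      using bounded_bilinear.comp1[OF bounded_bilinear_inner S.bounded_linear_axioms] .
    have sym: "inner (?S f) g = inner (?S g) f" for f g
      by (metis frame_operator_self_adjoint inner_commute inner_eq_Re_cinner)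
    obtain f where "\<And>g. inner (?S f) g = inner h g"
      by (rule coercive_symmetric_form_represents[OF bil sym A bounded_linear_inner_right])
        (rule that)
    then have "inner (?S f - h) (?S f - h) = 0"
      by (simp add: inner_diff_left)
    then show "\<exists>f. h = ?S f" by auto
  qed
qed

lemma inv_frame_operator_self_adjoint:
  "cinner (inv (frame_operator M F) f) g = cinner f (inv (frame_operator M F) g)"
proof -
  let ?S = "frame_operator M F"
  have right_inv: "?S (inv ?S h) = h" for h
    by (rule surj_f_inv_f[OF bij_is_surj[OF bij_frame_operator]])
  show ?thesis
    using frame_operator_self_adjoint[of "inv ?S f" "inv ?S g"] by (simp only: right_inv)
qed

lemma inv_frame_operator_bounded:
  obtains K where "\<And>f. norm (inv (frame_operator M F) f) \<le> K * norm f"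
proof -
  obtain A where A: "0 < A" "\<And>f. A * (norm f)\<^sup>2 \<le> inner (frame_operator M F f) f"
    by (rule frame_operator_coercive) (rule that)
  have "norm (inv (frame_operator M F) f) \<le> 1 / A * norm f" for f
  proof (cases "inv (frame_operator M F) f = 0")
    case False
    let ?g = "inv (frame_operator M F) f"
    have "A * (norm ?g)\<^sup>2 \<le> inner f ?g"
      using A(2)[of ?g] bij_frame_operator by (simp add: bij_is_surj surj_f_inv_f)
    also have "\<dots> \<le> norm f * norm ?g"
      by (rule norm_cauchy_schwarz)
    finally have "A * norm ?g \<le> norm f"
      using False by (simp add: power2_eq_square flip: mult.assoc)
    then show ?thesis
      using A(1) by (simp add: field_simps)
  qed (use A(1) in simp)
  then show thesis by (rule that)
qed

lemma bessel_canonical_dual: "bessel_mapping M (\<lambda>x. inv (frame_operator M F) (F x))"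
  by (rule inv_frame_operator_bounded)
    (rule bessel_mapping_image[OF continuous_frame_bessel[OF F]
      inv_frame_operator_self_adjoint[symmetric]])

lemma canonical_dual_reconstruction:
  "has_bochner_integral M (\<lambda>x. cinner f (F x) * cinner (inv (frame_operator M F) (F x)) g)
    (cinner f g)"
proof -
  let ?S = "frame_operator M F"
  have "has_bochner_integral M (\<lambda>x. cinner f (F x) * cinner (F x) (inv ?S g))
      (cinner (?S f) (inv ?S g))"
    unfolding frame_operator_eq_mixed
    by (intro mixed_frame_operator_has_integral continuous_frame_bessel F)
  also have "cinner (?S f) (inv ?S g) = cinner f g"
    using bij_frame_operator by (simp add: frame_operator_self_adjoint bij_is_surj surj_f_inv_f)
  finally show ?thesis
    by (simp add: inv_frame_operator_self_adjoint)
qed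

end

section \<open>Tensor products of Bessel mappings\<close>

definition orthonormal :: "'a::complex_inner set \<Rightarrow> bool"
  where "orthonormal E \<longleftrightarrow> (\<forall>e\<in>E. \<forall>e'\<in>E. cinner e e' = (if e = e' then 1 else 0))"

lemma orthonormal_sum_pick:
  assumes "finite E" "orthonormal E" "e \<in> E"
  shows "(\<Sum>x\<in>E. a x * cinner x e) = a e"
proof -
  have "(\<Sum>x\<in>E. a x * cinner x e) = (\<Sum>x\<in>E. if x = e then a x else 0)"
    using assms by (intro sum.cong) (auto simp: orthonormal_def)
  also have "\<dots> = a e"
    using assms by simp
  finally show ?thesis .
qed

context
  fixes tens :: "'a::complex_hilbert \<Rightarrow> 'b::complex_hilbert \<Rightarrow> 'c::complex_hilbert"
  assumes tens: "hilbert_tensor_product tens"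
begin

lemma tens_add_left: "tens (f + f') g = tens f g + tens f' g"
  and tens_add_right: "tens f (g + g') = tens f g + tens f g'"
  and tens_scaleC_left: "tens (c *\<^sub>C f) g = c *\<^sub>C tens f g"
  and tens_scaleC_right: "tens f (c *\<^sub>C g) = c *\<^sub>C tens f g"
  and cinner_tens: "cinner (tens f g) (tens f' g') = cinner f f' * cinner g g'"
  and tens_dense: "closure (span {tens f g | f g. True}) = UNIV"
  using tens unfolding hilbert_tensor_product_def by blast+

lemma tens_sum_right: "tens f (\<Sum>e\<in>E. v e) = (\<Sum>e\<in>E. tens f (v e))"
proof (induction E rule: infinite_finite_induct)
  have "tens f 0 = 0"
    using tens_add_right[of f 0 0] by simp
  then show "tens f (sum v {}) = (\<Sum>e\<in>{}. tens f (v e))"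
    and "infinite E \<Longrightarrow> tens f (sum v E) = (\<Sum>e\<in>E. tens f (v e))" for E
    by simp_all
qed (simp add: tens_add_right)

text \<open>A finite sum of elementary tensors can be rewritten with orthonormal second factors. This is the
  Gram--Schmidt process, carried out one elementary tensor at a time: the part of \<open>g\<close> in the span
  of \<open>E\<close> is absorbed by the coefficients, and the remainder \<open>r\<close> is normalised and joins \<open>E\<close>.\<close>

lemma span_tens_orthonormal_expansion:
  assumes "h \<in> span {tens f g | f g. True}"
  obtains E u where "finite E" and "orthonormal E"
    and "h = (\<Sum>e\<in>E. tens (u e) e)"
proof -
  have "\<exists>E u. finite E \<and> orthonormal E
      \<and> h = (\<Sum>e\<in>E. tens (u e) e)"
    using assms
  proof (induction rule: span_induct_alt)
    case base
    show ?case by (rule exI[of _ "{}"]) (simp add: orthonormal_def)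
  next
    case (step c x y)
    then obtain f0 g where "x = tens f0 g" by blast
    define f where "f = complex_of_real c *\<^sub>C f0"
    have x: "c *\<^sub>R x = tens f g"
      by (simp add: \<open>x = tens f0 g\<close> f_def tens_scaleC_left scaleR_eq_scaleC)
    obtain E u where E: "finite E" "orthonormal E"
      and y: "y = (\<Sum>e\<in>E. tens (u e) e)"
      using step by blast
    define r where "r = g - (\<Sum>e\<in>E. cinner g e *\<^sub>C e)"
    have r_orth: "cinner r e = 0" if "e \<in> E" for e
      using that E
      by (simp add: r_def cinner_diff_left cinner_sum_left cinner_scaleC_left
          orthonormal_sum_pick)
    define w where "w e = u e + cinner g e *\<^sub>C f" for e
    have "tens f g = tens f ((\<Sum>e\<in>E. cinner g e *\<^sub>C e) + r)"
      by (simp add: r_def)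
    also have "\<dots> = (\<Sum>e\<in>E. tens (cinner g e *\<^sub>C f) e) + tens f r"
      by (simp add: tens_add_right tens_sum_right tens_scaleC_left tens_scaleC_right)
    finally have sum: "c *\<^sub>R x + y = (\<Sum>e\<in>E. tens (w e) e) + tens f r"
      by (simp add: x y w_def tens_add_left sum.distrib)
    show ?case
    proof (cases "r = 0")
      case True
      then have "c *\<^sub>R x + y = (\<Sum>e\<in>E. tens (w e) e)"
        using sum tens_add_right[of f 0 0] by simp
      with E show ?thesis by blast
    next
      case False
      define e0 where "e0 = complex_of_real (1 / norm r) *\<^sub>C r"
      have e0_orth: "cinner e0 e = 0" "cinner e e0 = 0" if "e \<in> E" for e
        using r_orth[OF that] cinner_commute[of e r]
        by (simp_all add: e0_def cinner_scaleC_left cinner_scaleC_right)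
      have e0_unit: "cinner e0 e0 = 1"
        using False by (simp add: cinner_self e0_def norm_scaleC norm_divide)
      have "e0 \<notin> E"
        using e0_orth(1)[of e0] e0_unit by auto
      have "complex_of_real (norm r) *\<^sub>C e0 = r"
        using False by (simp add: e0_def scaleC_scaleC flip: scaleR_eq_scaleC of_real_mult
            del: of_real_divide)
      then have "tens (complex_of_real (norm r) *\<^sub>C f) e0 = tens f r"
        by (metis tens_scaleC_left tens_scaleC_right)
      then have "c *\<^sub>R x + y
          = (\<Sum>e\<in>insert e0 E. tens ((w(e0 := complex_of_real (norm r) *\<^sub>C f)) e) e)"
        using sum E(1) \<open>e0 \<notin> E\<close> by (auto simp: add.commute intro!: sum.cong)
      moreover have "orthonormal (insert e0 E)"
        using E(2) e0_orth e0_unit \<open>e0 \<notin> E\<close> by (auto simp: orthonormal_def)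
      ultimately show ?thesis
        using E(1) by (meson finite_insert)
    qed
  qed
  then show thesis using that by metis
qed

lemma norm_orthonormal_sum:
  fixes E :: "'b set"
  assumes "finite E" "orthonormal E"
  shows "(norm (\<Sum>e\<in>E. tens (u e) e))\<^sup>2 = (\<Sum>e\<in>E. (norm (u e))\<^sup>2)"
    and "(norm (\<Sum>e\<in>E. a e *\<^sub>C e))\<^sup>2 = (\<Sum>e\<in>E. (cmod (a e))\<^sup>2)"
proof -
  have "cinner (\<Sum>e\<in>E. tens (u e) e) (\<Sum>e\<in>E. tens (u e) e) = (\<Sum>e\<in>E. cinner (u e) (u e))"
    using assms by (simp add: cinner_sum_left cinner_sum_right cinner_tens orthonormal_sum_pick)
  then show "(norm (\<Sum>e\<in>E. tens (u e) e))\<^sup>2 = (\<Sum>e\<in>E. (norm (u e))\<^sup>2)"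
    unfolding cinner_self of_real_sum[symmetric] of_real_eq_iff .
  have "cinner (\<Sum>e\<in>E. a e *\<^sub>C e) (\<Sum>e\<in>E. a e *\<^sub>C e) = (\<Sum>e\<in>E. a e * cnj (a e))"
    using assms by (simp add: cinner_sum_left cinner_sum_right cinner_scaleC_left
        cinner_scaleC_right orthonormal_sum_pick mult.commute flip: sum_distrib_left)
  then show "(norm (\<Sum>e\<in>E. a e *\<^sub>C e))\<^sup>2 = (\<Sum>e\<in>E. (cmod (a e))\<^sup>2)"
    unfolding cinner_self complex_norm_square[symmetric] of_real_power[symmetric]
      of_real_sum[symmetric] of_real_eq_iff .
qed

lemma tensor_map_apply: "tensor_map tens P1 P2 z = tens (P1 (fst z)) (P2 (snd z))"
  by (simp add: tensor_map_def split_beta)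

text \<open>The coefficient with respect to an elementary tensor is a product of measurable functions of the
  two variables; by density every other coefficient is a pointwise limit of finite sums of these.\<close>

lemma weakly_measurable_tensor_map:
  assumes "weakly_measurable M1 P1" "weakly_measurable M2 P2"
  shows "weakly_measurable (M1 \<Otimes>\<^sub>M M2) (tensor_map tens P1 P2)"
proof -
  let ?P = "tensor_map tens P1 P2"
  note [measurable] = weakly_measurableD(1)[OF assms(1)] weakly_measurableD(1)[OF assms(2)]
  have span: "(\<lambda>z. cinner h (?P z)) \<in> borel_measurable (M1 \<Otimes>\<^sub>M M2)"
    if "h \<in> span {tens f g | f g. True}" for h
    using that
  proof (induction rule: span_induct_alt)
    case base
    show ?case by (simp add: cinner_zero_left)
  next
    case (step c x y)
    then obtain f g where "x = tens f g" by blast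
    then have "(\<lambda>z. cinner x (?P z)) \<in> borel_measurable (M1 \<Otimes>\<^sub>M M2)"
      by (simp add: tensor_map_apply cinner_tens)
    with step show ?case
      by (simp add: cinner_add_left scaleR_eq_scaleC cinner_scaleC_left)
  qed
  show ?thesis
    unfolding weakly_measurable_def
  proof
    fix h
    have "h \<in> closure (span {tens f g | f g. True})"
      unfolding tens_dense by simp
    then obtain s where s: "\<And>n. s n \<in> span {tens f g | f g. True}" "s \<longlonglongrightarrow> h"
      unfolding closure_sequential by blast
    show "(\<lambda>z. cinner h (?P z)) \<in> borel_measurable (M1 \<Otimes>\<^sub>M M2)"
      by (rule borel_measurable_LIMSEQ_metric[OF span[OF s(1)]])
        (rule bounded_linear.tendsto[OF bounded_linear_cinner_left s(2)])
  qed
qed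

text \<open>For \<open>h = (\<Sum>e\<in>E. tens (u e) e)\<close> with \<open>E\<close> orthonormal, Tonelli allows the Bessel bounds to be
  applied one variable at a time. The integral over the second variable is at most a multiple of
  \<open>(\<Sum>e\<in>E. (cmod (cinner (u e) (P1 x)))\<^sup>2)\<close>, whose integral over the first is at most a multiple of
  \<open>(\<Sum>e\<in>E. (norm (u e))\<^sup>2) = (norm h)\<^sup>2\<close>. Fatou's lemma passes from such \<open>h\<close> to their limits.\<close>

lemma bessel_mapping_tensor_map:
  assumes "sigma_finite_measure M2" and P1: "bessel_mapping M1 P1" and P2: "bessel_mapping M2 P2"
  shows "bessel_mapping (M1 \<Otimes>\<^sub>M M2) (tensor_map tens P1 P2)"
proof -
  let ?P = "tensor_map tens P1 P2"
  let ?M = "M1 \<Otimes>\<^sub>M M2"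
  let ?q = "\<lambda>h z. ennreal ((cmod (cinner h (?P z)))\<^sup>2)"
  interpret M2: sigma_finite_measure M2 by fact
  obtain C where C: "0 \<le> C" "weakly_measurable M1 P1"
    "\<And>f. (\<integral>\<^sup>+ x. ennreal ((cmod (cinner f (P1 x)))\<^sup>2) \<partial>M1) \<le> ennreal ((C * norm f)\<^sup>2)"
    by (rule bessel_mappingE[OF P1]) (rule that)
  obtain D where D: "0 \<le> D" "weakly_measurable M2 P2"
    "\<And>f. (\<integral>\<^sup>+ x. ennreal ((cmod (cinner f (P2 x)))\<^sup>2) \<partial>M2) \<le> ennreal ((D * norm f)\<^sup>2)"
    by (rule bessel_mappingE[OF P2]) (rule that)
  note meas = weakly_measurable_tensor_map[OF C(2) D(2)]
  note [measurable] = weakly_measurableD(1)[OF meas] weakly_measurableD(1)[OF C(2)]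
  have span: "(\<integral>\<^sup>+ z. ?q h z \<partial>?M) \<le> ennreal ((C * D * norm h)\<^sup>2)"
    if h: "h \<in> span {tens f g | f g. True}" for h
  proof -
    obtain E u where E: "finite E" "orthonormal E"
      and h: "h = (\<Sum>e\<in>E. tens (u e) e)"
      by (rule span_tens_orthonormal_expansion[OF h]) (rule that)
    have inner: "(\<integral>\<^sup>+ y. ?q h (x, y) \<partial>M2)
        \<le> ennreal (D\<^sup>2) * (\<Sum>e\<in>E. ennreal ((cmod (cinner (u e) (P1 x)))\<^sup>2))" for x
    proof -
      have "cinner h (?P (x, y)) = cinner (\<Sum>e\<in>E. cinner (u e) (P1 x) *\<^sub>C e) (P2 y)" for y
        by (simp add: h tensor_map_apply cinner_sum_left cinner_tens cinner_scaleC_left)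
      then have "(\<integral>\<^sup>+ y. ?q h (x, y) \<partial>M2)
          \<le> ennreal ((D * norm (\<Sum>e\<in>E. cinner (u e) (P1 x) *\<^sub>C e))\<^sup>2)"
        using D(3) by simp
      also have "\<dots> = ennreal (D\<^sup>2) * (\<Sum>e\<in>E. ennreal ((cmod (cinner (u e) (P1 x)))\<^sup>2))"
        by (simp add: power_mult_distrib norm_orthonormal_sum(2)[OF E] ennreal_mult sum_nonneg
            sum_ennreal)
      finally show ?thesis .
    qed
    have "(\<integral>\<^sup>+ z. ?q h z \<partial>?M) = (\<integral>\<^sup>+ x. \<integral>\<^sup>+ y. ?q h (x, y) \<partial>M2 \<partial>M1)"
      by (rule M2.nn_integral_fst[symmetric]) measurable
    also have "\<dots> \<le> (\<integral>\<^sup>+ x. ennreal (D\<^sup>2) * (\<Sum>e\<in>E. ennreal ((cmod (cinner (u e) (P1 x)))\<^sup>2)) \<partial>M1)"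
      by (intro nn_integral_mono inner)
    also have "\<dots> = ennreal (D\<^sup>2) * (\<Sum>e\<in>E. \<integral>\<^sup>+ x. ennreal ((cmod (cinner (u e) (P1 x)))\<^sup>2) \<partial>M1)"
      by (simp add: nn_integral_cmult nn_integral_sum del: sum_ennreal)
    also have "\<dots> \<le> ennreal (D\<^sup>2) * (\<Sum>e\<in>E. ennreal ((C * norm (u e))\<^sup>2))"
      by (intro mult_left_mono sum_mono C(3)) simp
    also have "\<dots> = ennreal ((C * D * norm h)\<^sup>2)"
      by (simp add: h power_mult_distrib norm_orthonormal_sum(1)[OF E] sum_ennreal sum_nonneg
          sum_distrib_left mult_ac flip: ennreal_mult)
    finally show ?thesis .
  qed
  show ?thesis
  proof (rule bessel_mappingI[OF meas, where C="C * D"])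
    fix h
    have "h \<in> closure (span {tens f g | f g. True})"
      unfolding tens_dense by simp
    then obtain s where s: "\<And>n. s n \<in> span {tens f g | f g. True}" "s \<longlonglongrightarrow> h"
      unfolding closure_sequential by blast
    have lim: "(\<lambda>n. ?q (s n) z) \<longlonglongrightarrow> ?q h z" for z
      by (intro tendsto_ennrealI tendsto_intros
          bounded_linear.tendsto[OF bounded_linear_cinner_left s(2)])
    have "(\<integral>\<^sup>+ z. ?q h z \<partial>?M) = (\<integral>\<^sup>+ z. liminf (\<lambda>n. ?q (s n) z) \<partial>?M)"
      using lim_imp_Liminf[OF trivial_limit_sequentially lim] by simp
    also have "\<dots> \<le> liminf (\<lambda>n. \<integral>\<^sup>+ z. ?q (s n) z \<partial>?M)"
      by (rule nn_integral_liminf) measurable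
    also have "\<dots> \<le> liminf (\<lambda>n. ennreal ((C * D * norm (s n))\<^sup>2))"
      by (intro Liminf_mono always_eventually allI span s)
    also have "\<dots> = ennreal ((C * D * norm h)\<^sup>2)"
      by (intro lim_imp_Liminf trivial_limit_sequentially tendsto_ennrealI tendsto_intros s(2))
    finally show "(\<integral>\<^sup>+ z. ?q h z \<partial>?M) \<le> ennreal ((C * D * norm h)\<^sup>2)" .
  qed
qed

end

lemma has_bochner_integral_pair_times:
  fixes f :: "'x \<Rightarrow> complex" and g :: "'y \<Rightarrow> complex"
  assumes "sigma_finite_measure M1" "sigma_finite_measure M2"
    and f: "has_bochner_integral M1 f a" and g: "has_bochner_integral M2 g b"
  shows "has_bochner_integral (M1 \<Otimes>\<^sub>M M2) (\<lambda>z. f (fst z) * g (snd z)) (a * b)"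
proof -
  interpret pair_sigma_finite M1 M2
    using assms(1,2) by (simp add: pair_sigma_finite_def)
  have [measurable]: "f \<in> borel_measurable M1" "g \<in> borel_measurable M2"
    using f g by (auto simp: has_bochner_integral_iff)
  have int: "integrable (M1 \<Otimes>\<^sub>M M2) (\<lambda>z. f (fst z) * g (snd z))"
  proof (rule Fubini_integrable)
    show "integrable M1 (\<lambda>x. \<integral> y. norm (f (fst (x, y)) * g (snd (x, y))) \<partial>M2)"
      using f g by (simp add: norm_mult has_bochner_integral_iff)
    show "AE x in M1. integrable M2 (\<lambda>y. f (fst (x, y)) * g (snd (x, y)))"
      using g by (simp add: has_bochner_integral_iff)
  qed measurable
  moreover have "(\<integral> z. f (fst z) * g (snd z) \<partial>(M1 \<Otimes>\<^sub>M M2)) = a * b"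
    using integral_fst'[OF int] f g by (simp add: has_bochner_integral_iff)
  ultimately show ?thesis
    by (simp add: has_bochner_integral_iff)
qed

section \<open>Dual frames of tensor products\<close>

text \<open>On elementary tensors the reconstruction formula factorises, by Fubini, into those of the two
  factors. Both sides are bounded operators, so that agreement on elementary tensors suffices, first
  for the right argument of the inner product and then for the operator itself.\<close>

lemma tensor_map_duality:
  fixes tens :: "'a::complex_hilbert \<Rightarrow> 'b::complex_hilbert \<Rightarrow> 'c::complex_hilbert"
  assumes tens: "hilbert_tensor_product tens"
    and sf: "sigma_finite_measure M1" "sigma_finite_measure M2"
    and Bessel: "bessel_mapping M1 F1" "bessel_mapping M2 F2"
      "bessel_mapping M1 D1" "bessel_mapping M2 D2"
    and dual1: "\<And>f g. has_bochner_integral M1 (\<lambda>x. cinner f (F1 x) * cinner (D1 x) g) (cinner f g)"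
    and dual2: "\<And>f g. has_bochner_integral M2 (\<lambda>x. cinner f (F2 x) * cinner (D2 x) g) (cinner f g)"
  shows "mixed_frame_operator (M1 \<Otimes>\<^sub>M M2) (tensor_map tens F1 F2) (tensor_map tens D1 D2) = (\<lambda>f. f)"
    (is "?R = _")
proof -
  let ?T = "{tens f g | f g. True}"
  note dense = tens_dense[OF tens]
  note F = bessel_mapping_tensor_map[OF tens sf(2) Bessel(1,2)]
  note D = bessel_mapping_tensor_map[OF tens sf(2) Bessel(3,4)]
  have everywhere: "p = q" if "bounded_linear p" "bounded_linear q"
    and eq: "\<And>f g. p (tens f g) = q (tens f g)" for p q :: "'c \<Rightarrow> 'z::real_normed_vector"
  proof
    fix h
    have "closed {h. p h = q h}"
      using that by (intro closed_Collect_eq linear_continuous_on)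
    moreover have "span ?T \<subseteq> {h. p h = q h}"
    proof
      show "h \<in> {h. p h = q h}" if "h \<in> span ?T" for h
        using linear_eq_on[OF bounded_linear.linear bounded_linear.linear that]
          \<open>bounded_linear p\<close> \<open>bounded_linear q\<close> eq by auto
    qed
    ultimately show "p h = q h"
      using closure_minimal[of "span ?T"] dense by blast
  qed
  have "cinner (?R (tens f g)) (tens f' g') = cinner (tens f g) (tens f' g')" for f g f' g'
  proof -
    have "has_bochner_integral (M1 \<Otimes>\<^sub>M M2)
       (\<lambda>z. cinner (tens f g) (tensor_map tens F1 F2 z) * cinner (tensor_map tens D1 D2 z) (tens f' g'))
       (cinner (tens f g) (tens f' g'))"
      using has_bochner_integral_pair_times[OF sf dual1[of f f'] dual2[of g g']]
      by (simp add: tensor_map_apply[OF tens] cinner_tens[OF tens] mult_ac)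
    then show ?thesis
      by (rule has_bochner_integral_eq[OF mixed_frame_operator_has_integral[OF F D]])
  qed
  then have eq: "cinner (?R (tens f g)) = cinner (tens f g)" for f g
    by (intro everywhere bounded_linear_cinner_right)
  have "?R (tens f g) = tens f g" for f g
    by (rule cinner_ext[OF fun_cong[OF eq]])
  then show ?thesis
    by (intro everywhere bounded_linear_mixed_frame_operator F D bounded_linear_ident)
qed

theorem corollary4p7:
  fixes M1 :: "'x measure" and M2 :: "'y measure"
    and F1 :: "'x \<Rightarrow> 'a::complex_hilbert" and F2 :: "'y \<Rightarrow> 'b::complex_hilbert"
    and tens :: "'a \<Rightarrow> 'b \<Rightarrow> 'c::complex_hilbert"
  assumes "separable_space (euclidean :: 'a topology)"
    and "separable_space (euclidean :: 'b topology)"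
    and "hilbert_tensor_product tens"
    and "sigma_finite_measure M1" and "sigma_finite_measure M2"
    and "continuous_frame M1 F1" and "continuous_frame M2 F2"
  shows "continuous_frame (M1 \<Otimes>\<^sub>M M2) (tensor_map tens F1 F2) \<and>
    (\<forall>G :: 'x \<times> 'y \<Rightarrow> 'c.
      dual_frame (M1 \<Otimes>\<^sub>M M2) (tensor_map tens F1 F2) G \<longleftrightarrow>
      (\<exists>W. bessel_mapping (M1 \<Otimes>\<^sub>M M2) W \<and>
        (\<forall>x1 \<in> space M1. \<forall>x2 \<in> space M2.
          G (x1, x2) =
            tens (inv (frame_operator M1 F1) (F1 x1)) (inv (frame_operator M2 F2) (F2 x2))
            + W (x1, x2)
            - weak_integral (M1 \<Otimes>\<^sub>M M2) (\<lambda>(y1, y2).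
                (cinner (inv (frame_operator M1 F1) (F1 x1)) (F1 y1)
                 * cinner (inv (frame_operator M2 F2) (F2 x2)) (F2 y2)) *\<^sub>C W (y1, y2)))))"
proof -
  note tens = \<open>hilbert_tensor_product tens\<close>
  define D1 where "D1 x = inv (frame_operator M1 F1) (F1 x)" for x
  define D2 where "D2 x = inv (frame_operator M2 F2) (F2 x)" for x
  define F where "F = tensor_map tens F1 F2"
  define D where "D = tensor_map tens D1 D2"
  note bessel_factors = continuous_frame_bessel[OF assms(6)] continuous_frame_bessel[OF assms(7)]
    bessel_canonical_dual[OF assms(6), folded D1_def] bessel_canonical_dual[OF assms(7), folded D2_def]
  have F: "bessel_mapping (M1 \<Otimes>\<^sub>M M2) F" and D: "bessel_mapping (M1 \<Otimes>\<^sub>M M2) D"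
    unfolding F_def D_def by (intro bessel_mapping_tensor_map tens assms bessel_factors)+
  have dual: "mixed_frame_operator (M1 \<Otimes>\<^sub>M M2) F D = (\<lambda>f. f)"
    unfolding F_def D_def
    using canonical_dual_reconstruction[OF assms(6)] canonical_dual_reconstruction[OF assms(7)]
    by (intro tensor_map_duality tens assms bessel_factors) (simp_all add: D1_def D2_def)
  have kernel: "weak_integral (M1 \<Otimes>\<^sub>M M2) (\<lambda>(y1, y2).
        (cinner (D1 x1) (F1 y1) * cinner (D2 x2) (F2 y2)) *\<^sub>C W (y1, y2))
      = mixed_frame_operator (M1 \<Otimes>\<^sub>M M2) F W (D (x1, x2))" for W :: "'x \<times> 'y \<Rightarrow> 'c" and x1 x2
    unfolding mixed_frame_operator_def F_def D_def tensor_map_def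
    by (rule arg_cong[where f = "weak_integral _"]) (auto simp: cinner_tens[OF tens])
  have D_apply: "tens (D1 x1) (D2 x2) = D (x1, x2)" for x1 x2
    by (simp add: D_def tensor_map_def)
  have "continuous_frame (M1 \<Otimes>\<^sub>M M2) F"
    by (rule bessel_duality_imp_frame[OF F D dual])
  moreover have "dual_frame (M1 \<Otimes>\<^sub>M M2) F G \<longleftrightarrow>
      (\<exists>W. bessel_mapping (M1 \<Otimes>\<^sub>M M2) W \<and> (\<forall>x1 \<in> space M1. \<forall>x2 \<in> space M2.
        G (x1, x2) = D (x1, x2) + W (x1, x2) - mixed_frame_operator (M1 \<Otimes>\<^sub>M M2) F W (D (x1, x2))))" for G
    unfolding dual_frames_from_one_dual[OF F D dual] by (auto simp: space_pair_measure)
  ultimately show ?thesis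
    unfolding D1_def[symmetric] D2_def[symmetric] kernel D_apply F_def[symmetric] by blast
qed

end
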